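(* Let $(\phi_t)$ be a semigroup of finite shift in $\mathbb{D}$ whose Koenigs domain is contained in the upper half-plane $\{\mathrm{Im}\,w>0\}$, and let $(T_t)$ be the induced semigroup of composition operators acting on the Hardy space $H^p$, $p\ge1$. Then the point spectrum $\sigma_p$ of the infinitesimal generator of $(T_t)$ is $\sigma_p=\{it:t\ge0\}$.
   Context: $\mathbb{D}$ is the open unit disk. A semigroup in $\mathbb{D}$ is a family $(\phi_t)_{t\ge0}$ of holomorphic maps $\phi_t:\mathbb{D}\to\mathbb{D}$ with $\phi_0=\mathrm{id}$, $\phi_{t+s}=\phi_t\circ\phi_s$ for all $t,s\ge0$, and $\phi_t(z)\to z$ uniformly on compacta as $t\to0^+$. It is non-elliptic if there is $\tau\in\partial\mathbb{D}$ (the Denjoy–Wolff point) with $\phi_t(z)\to\tau$ as $t\to+\infty$ for all $z\in\mathbb{D}$. For a non-elliptic semigroup there is a univalent map $h:\mathbb{D}\to\mathbb{C}$, unique up to translation, the Koenigs function, with $h(\phi_t(z))=h(z)+t$ for all $t\ge0$, $z\in\mathbb{D}$; $h(\mathbb{D})$ is the Koenigs domain. A horodisk centered at $\tau$ is a disk contained in $\mathbb{D}$ internally tangent to $\partial\mathbb{D}$ at $\tau$. A non-elliptic semigroup is of finite shift if there is $z\in\mathbb{D}$ whose orbit $\{\phi_t(z):t\ge0\}$ does not intersect some horodisk centered at $\tau$. (Such semigroups have Koenigs domain contained in a horizontal half-plane.) $H^p$ is the Banach space of holomorphic $f$ on $\mathbb{D}$ with $\|f\|_{H^p}^p=\sup_{0\le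 r<1}\int_0^{2\pi}|f(re^{i\theta})|^p\,d\theta<+\infty$. On $H^p$, $T_t(f)=f\circ\phi_t$ is a strongly continuous semigroup of bounded operators; its infinitesimal generator is $\Gamma(f)=\lim_{t\to0^+}(T_t(f)-f)/t$ (norm limit), defined on those $f\in H^p$ for which the limit exists in $H^p$. The point spectrum is the set of eigenvalues $\lambda\in\mathbb{C}$ of $\Gamma$. *)

theory Defs
  imports "HOL-Complex_Analysis.Complex_Analysis"
begin

abbreviation unit_disk :: "complex set" where
  "unit_disk \<equiv> ball 0 1"

text \<open>
  Functions on the disk are total functions \<^typ>\<open>complex \<Rightarrow> complex\<close>; their values outside
  \<^term>\<open>unit_disk\<close> are irrelevant, and so are the maps \<^term>\<open>\<phi> t\<close> for negative \<^term>\<open>t\<close>.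
\<close>

definition disk_semigroup :: "(real \<Rightarrow> complex \<Rightarrow> complex) \<Rightarrow> bool" where
  "disk_semigroup \<phi> \<longleftrightarrow>
     (\<forall>t\<ge>0. \<phi> t holomorphic_on unit_disk \<and> \<phi> t ` unit_disk \<subseteq> unit_disk) \<and>
     (\<forall>z\<in>unit_disk. \<phi> 0 z = z) \<and>
     (\<forall>t\<ge>0. \<forall>s\<ge>0. \<forall>z\<in>unit_disk. \<phi> (t + s) z = \<phi> t (\<phi> s z)) \<and>
     (\<forall>K. compact K \<and> K \<subseteq> unit_disk \<longrightarrow> uniform_limit K \<phi> (\<lambda>z. z) (at_right 0))"

definition denjoy_wolff_point :: "(real \<Rightarrow> complex \<Rightarrow> complex) \<Rightarrow> complex \<Rightarrow> bool" where
  "denjoy_wolff_point \<phi> \<tau> \<longleftrightarrow>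
     \<tau> \<in> sphere 0 1 \<and> (\<forall>z\<in>unit_disk. ((\<lambda>t. \<phi> t z) \<longlongrightarrow> \<tau>) at_top)"

definition non_elliptic_semigroup :: "(real \<Rightarrow> complex \<Rightarrow> complex) \<Rightarrow> bool" where
  "non_elliptic_semigroup \<phi> \<longleftrightarrow> disk_semigroup \<phi> \<and> (\<exists>\<tau>. denjoy_wolff_point \<phi> \<tau>)"

text \<open>
  A disk of radius \<^term>\<open>r\<close> in the unit disk that is internally tangent to the unit circle
  at \<^term>\<open>\<tau>\<close> has its centre on the radius towards \<^term>\<open>\<tau>\<close>, at distance \<^term>\<open>r\<close> from \<^term>\<open>\<tau>\<close>.
\<close>

definition horodisk :: "complex \<Rightarrow> complex set \<Rightarrow> bool" where
  "horodisk \<tau> H \<longleftrightarrow> (\<exists>r. 0 < r \<and> r < 1 \<and> H = ball (of_real (1 - r) * \<tau>) r)"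

definition finite_shift_semigroup :: "(real \<Rightarrow> complex \<Rightarrow> complex) \<Rightarrow> bool" where
  "finite_shift_semigroup \<phi> \<longleftrightarrow>
     non_elliptic_semigroup \<phi> \<and>
     (\<exists>\<tau> H. denjoy_wolff_point \<phi> \<tau> \<and> horodisk \<tau> H \<and>
        (\<exists>z\<in>unit_disk. {\<phi> t z | t. t \<ge> 0} \<inter> H = {}))"

definition koenigs_function ::
    "(real \<Rightarrow> complex \<Rightarrow> complex) \<Rightarrow> (complex \<Rightarrow> complex) \<Rightarrow> bool" where
  "koenigs_function \<phi> h \<longleftrightarrow>
     h holomorphic_on unit_disk \<and> inj_on h unit_disk \<and>
     (\<forall>t\<ge>0. \<forall>z\<in>unit_disk. h (\<phi> t z) = h z + of_real t)"

definition hardy_mean :: "real \<Rightarrow> (complex \<Rightarrow> complex) \<Rightarrow> real \<Rightarrow> real" where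
  "hardy_mean p f r = integral {0..2 * pi} (\<lambda>\<theta>. norm (f (of_real r * cis \<theta>)) powr p)"

definition hardy_space :: "real \<Rightarrow> (complex \<Rightarrow> complex) set" where
  "hardy_space p = {f. f holomorphic_on unit_disk \<and> bdd_above (hardy_mean p f ` {0..<1})}"

definition hardy_norm :: "real \<Rightarrow> (complex \<Rightarrow> complex) \<Rightarrow> real" where
  "hardy_norm p f = (SUP r\<in>{0..<1}. hardy_mean p f r) powr (1 / p)"

text \<open>
  Norm convergence in \<^term>\<open>hardy_space p\<close>. Membership is demanded because \<^const>\<open>hardy_norm\<close>
  is an unspecified number outside the space.
\<close>

definition hardy_tendsto ::
    "real \<Rightarrow> ('a \<Rightarrow> complex \<Rightarrow> complex) \<Rightarrow> (complex \<Rightarrow> complex) \<Rightarrow> 'a filter \<Rightarrow> bool" where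
  "hardy_tendsto p F g A \<longleftrightarrow>
     g \<in> hardy_space p \<and> (\<forall>\<^sub>F t in A. F t \<in> hardy_space p) \<and>
     ((\<lambda>t. hardy_norm p (\<lambda>z. F t z - g z)) \<longlongrightarrow> 0) A"

definition composition_semigroup ::
    "(real \<Rightarrow> complex \<Rightarrow> complex) \<Rightarrow> real \<Rightarrow> (complex \<Rightarrow> complex) \<Rightarrow> complex \<Rightarrow> complex" where
  "composition_semigroup \<phi> t f = f \<circ> \<phi> t"

text \<open>
  The infinitesimal generator on \<^term>\<open>hardy_space p\<close>, an unbounded operator, given by its graph:
  \<^term>\<open>f\<close> lies in the domain iff it is related to some \<^term>\<open>g\<close>, which is then unique on the disk.
\<close>

definition hardy_generator ::
    "real \<Rightarrow> (real \<Rightarrow> complex \<Rightarrow> complex) \<Rightarrow> ((complex \<Rightarrow> complex) \<times> (complex \<Rightarrow> complex)) set" where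
  "hardy_generator p \<phi> =
     {(f, g). f \<in> hardy_space p \<and>
        hardy_tendsto p (\<lambda>t z. (composition_semigroup \<phi> t f z - f z) / of_real t) g (at_right 0)}"

definition hardy_point_spectrum :: "real \<Rightarrow> (real \<Rightarrow> complex \<Rightarrow> complex) \<Rightarrow> complex set" where
  "hardy_point_spectrum p \<phi> =
     {\<mu>. \<exists>f. (f, \<lambda>z. \<mu> * f z) \<in> hardy_generator p \<phi> \<and> (\<exists>z\<in>unit_disk. f z \<noteq> 0)}"

end

theory Submission
  imports Defs
begin

text \<open>
  In the coordinate given by the Koenigs function \<open>h\<close> the semigroup is a translation and its
  generator is differentiation, so an eigenfunction \<open>f\<close> for \<open>\<mu>\<close> is a multiple of \<open>exp (\<mu> h)\<close>: norm
  convergence in the Hardy space implies pointwise convergence, so \<open>F = f \<circ> h\<^sup>-\<^sup>1\<close> satisfies \<open>F' =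
  \<mu> F\<close> on the connected Koenigs domain (\<open>Koenigs_eigenfunction\<close>). Conversely \<open>exp (\<mu> h)\<close> is an
  eigenfunction as soon as it is bounded (\<open>hardy_generator_exp_Koenigs\<close>), which for \<open>\<mu> = \<i> t\<close>, \<open>t
  \<ge> 0\<close>, is clear from \<open>Im h > 0\<close>.

  It remains to exclude every other \<open>\<mu>\<close>. Point evaluation bounds a Hardy function by a multiple
  of \<open>1 / (1 - |z|)\<close> (\<open>hardy_point_evaluation\<close>). Transport the disk to the upper half-plane by a
  Cayley map that takes the Denjoy-Wolff point to infinity, and let \<open>g\<close> be the Koenigs function
  read there, a self-map of the half-plane. The bound for \<open>exp (\<mu> g)\<close> grows only linearly on each
  ray, whereas finite shift makes \<open>g\<close> itself behave like \<open>c w\<close> on each ray, with \<open>c > 0\<close>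
  (\<open>Koenigs_function_asymptotics\<close>). So \<open>exp (\<mu> g)\<close> would grow exponentially on a ray through any
  \<open>\<zeta>\<close> with \<open>Re (\<mu> \<zeta>) > 0\<close>; hence \<open>Re (\<mu> \<zeta>) \<le> 0\<close> on the whole upper half-plane, which says exactly
  that \<open>\<mu> = \<i> t\<close> with \<open>t \<ge> 0\<close>.

  The asymptotics rest on the Schwarz-Pick inequality alone. The orbit \<open>x\<^sub>n\<close> given by finite
  shift has bounded imaginary part, because it avoids a horodisk, and by Wolff's lemma the
  imaginary part does not decrease. Its hyperbolic steps do not increase, so its Euclidean steps
  are bounded and \<open>|x\<^sub>n|\<close> grows at most linearly. Comparing \<open>z\<close> with \<open>x\<^sub>n\<close>, where \<open>g (x\<^sub>n) = g
  (x\<^sub>0) + n\<close>, and letting \<open>n\<close> tend to infinity gives \<open>Im g \<ge> b Im\<close> for some \<open>b > 0\<close>, and the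
  Julia-Wolff-Caratheodory theorem does the rest.
\<close>

section \<open>The Cayley transform\<close>

abbreviation upper_half_plane :: "complex set" where
  "upper_half_plane \<equiv> {w. 0 < Im w}"

text \<open>
  The Cayley transform that sends \<open>a\<close> to \<open>0\<close> and infinity to \<open>1\<close>, and its inverse. The base point \<open>a\<close> is
  kept free: the Schwarz-Pick inequality moves arbitrary points to the origin, while a semigroup
  only needs \<open>a = \<i>\<close>.
\<close>

definition halfplane_to_disk :: "complex \<Rightarrow> complex \<Rightarrow> complex" where
  "halfplane_to_disk a z = (z - a) / (z - cnj a)"

definition disk_to_halfplane :: "complex \<Rightarrow> complex \<Rightarrow> complex" where
  "disk_to_halfplane a u = (a - cnj a * u) / (1 - u)"

lemma halfplane_minus_cnj_nonzero:
  assumes "0 < Im a" "0 < Im z" shows "z - cnj a \<noteq> 0"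
  using assms by (auto simp: complex_eq_iff)

lemma norm_diff_cnj_sq:
  "(cmod (z - cnj w))\<^sup>2 = (cmod (z - w))\<^sup>2 + 4 * Im z * Im w"
  unfolding cmod_power2 by (simp add: power2_eq_square algebra_simps)

lemma norm_halfplane_to_disk_sq:
  assumes "0 < Im a" "0 < Im z"
  shows "1 - (cmod (halfplane_to_disk a z))\<^sup>2 = 4 * Im z * Im a / (cmod (z - cnj a))\<^sup>2"
proof -
  let ?D = "(cmod (z - cnj a))\<^sup>2"
  have "(cmod (halfplane_to_disk a z))\<^sup>2 = (cmod (z - a))\<^sup>2 / ?D"
    by (simp add: halfplane_to_disk_def norm_divide power_divide)
  moreover have "?D \<noteq> 0" using halfplane_minus_cnj_nonzero[OF assms] by simp
  ultimately have "1 - (cmod (halfplane_to_disk a z))\<^sup>2 = (?D - (cmod (z - a))\<^sup>2) / ?D"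
    by (simp add: diff_divide_distrib)
  then show ?thesis by (simp add: norm_diff_cnj_sq)
qed

lemma norm_halfplane_to_disk_less_1:
  assumes "0 < Im a" "0 < Im z" shows "cmod (halfplane_to_disk a z) < 1"
proof -
  have "0 < 1 - (cmod (halfplane_to_disk a z))\<^sup>2"
    using halfplane_minus_cnj_nonzero[OF assms] assms
    unfolding norm_halfplane_to_disk_sq[OF assms] by (intro divide_pos_pos) auto
  then show ?thesis by (simp add: abs_square_less_1)
qed

lemma Im_disk_to_halfplane:
  assumes "cmod u < 1"
  shows "Im (disk_to_halfplane a u) = Im a * (1 - (cmod u)\<^sup>2) / (cmod (1 - u))\<^sup>2"
proof -
  have "u \<noteq> 1" using assms by auto
  have "disk_to_halfplane a u = (a - cnj a * u) * cnj (1 - u) / (of_real ((cmod (1 - u))\<^sup>2))"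
    unfolding disk_to_halfplane_def using complex_div_cnj by blast
  also have "Im \<dots> = Im ((a - cnj a * u) * cnj (1 - u)) / (cmod (1 - u))\<^sup>2"
    by (rule Im_divide_of_real)
  also have "Im ((a - cnj a * u) * cnj (1 - u)) = Im a * (1 - (cmod u)\<^sup>2)"
    unfolding cmod_power2 by (simp add: power2_eq_square algebra_simps)
  finally show ?thesis .
qed

lemma Im_disk_to_halfplane_pos:
  assumes "0 < Im a" "cmod u < 1" shows "0 < Im (disk_to_halfplane a u)"
proof -
  have "(cmod u)\<^sup>2 < 1" using assms by (simp add: abs_square_less_1)
  moreover have "u \<noteq> 1" using assms by auto
  ultimately show ?thesis
    using assms by (auto simp: Im_disk_to_halfplane intro!: divide_pos_pos mult_pos_pos)
qed

lemma halfplane_to_disk_inverse: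
  assumes "0 < Im a" "0 < Im z"
  shows "disk_to_halfplane a (halfplane_to_disk a z) = z"
proof -
  have n: "z - cnj a \<noteq> 0" by (rule halfplane_minus_cnj_nonzero[OF assms])
  have m: "a - cnj a \<noteq> 0" using assms by (auto simp: complex_eq_iff)
  have "1 - halfplane_to_disk a z = (a - cnj a) / (z - cnj a)"
    using n by (simp add: halfplane_to_disk_def field_simps)
  moreover have "a - cnj a * halfplane_to_disk a z = z * (a - cnj a) / (z - cnj a)"
    using n by (simp add: halfplane_to_disk_def field_simps)
  ultimately show ?thesis using n m by (simp add: disk_to_halfplane_def)
qed

lemma disk_to_halfplane_inverse:
  assumes "0 < Im a" "cmod u < 1"
  shows "halfplane_to_disk a (disk_to_halfplane a u) = u"
proof -
  have n: "1 - u \<noteq> 0" using assms by auto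
  have m: "a - cnj a \<noteq> 0" using assms by (auto simp: complex_eq_iff)
  have "disk_to_halfplane a u - a = u * (a - cnj a) / (1 - u)"
    using n by (simp add: disk_to_halfplane_def field_simps)
  moreover have "disk_to_halfplane a u - cnj a = (a - cnj a) / (1 - u)"
    using n by (simp add: disk_to_halfplane_def field_simps)
  ultimately show ?thesis using n m by (simp add: halfplane_to_disk_def)
qed

lemma holomorphic_halfplane_to_disk:
  assumes "0 < Im a" shows "halfplane_to_disk a holomorphic_on upper_half_plane"
  unfolding halfplane_to_disk_def
  using halfplane_minus_cnj_nonzero[OF assms] by (intro holomorphic_intros) auto

lemma holomorphic_disk_to_halfplane:
  "disk_to_halfplane a holomorphic_on unit_disk"
  unfolding disk_to_halfplane_def by (intro holomorphic_intros) auto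

section \<open>Holomorphic self-maps of the upper half-plane\<close>

text \<open>
  The Schwarz lemma, conjugated by Cayley transforms that move \<open>w\<close> and \<open>F w\<close> to the origin. The
  inequality compares \<open>|z - w|\<^sup>2 / (Im z Im w)\<close>, which is \<open>4 sinh\<^sup>2\<close> of half the hyperbolic distance; it
  is written without denominators so that limits can be taken in its variables.
\<close>

lemma Schwarz_Pick_halfplane:
  assumes F: "F holomorphic_on upper_half_plane" "\<And>z. 0 < Im z \<Longrightarrow> 0 < Im (F z)"
    and z: "0 < Im z" and w: "0 < Im w"
  shows "Im z * Im w * (cmod (F z - F w))\<^sup>2 \<le> Im (F z) * Im (F w) * (cmod (z - w))\<^sup>2"
proof -
  define q where "q = halfplane_to_disk (F w) \<circ> (F \<circ> disk_to_halfplane w)"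
  have im: "disk_to_halfplane w u \<in> upper_half_plane" if "u \<in> unit_disk" for u
    using that Im_disk_to_halfplane_pos[OF w] by simp
  have "F \<circ> disk_to_halfplane w holomorphic_on unit_disk"
    by (rule holomorphic_on_compose_gen[OF holomorphic_disk_to_halfplane F(1)]) (use im in auto)
  then have hq: "q holomorphic_on unit_disk"
    unfolding q_def
    by (rule holomorphic_on_compose_gen[OF _ holomorphic_halfplane_to_disk])
       (use F(2) w im in auto)
  have q0: "q 0 = 0" by (simp add: q_def disk_to_halfplane_def halfplane_to_disk_def)
  have q1: "cmod (q u) < 1" if "cmod u < 1" for u
    using that norm_halfplane_to_disk_less_1 F(2) w Im_disk_to_halfplane_pos[OF w] by (simp add: q_def)
  have x: "cmod (halfplane_to_disk w z) < 1" using norm_halfplane_to_disk_less_1 w z .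
  have "cmod (q (halfplane_to_disk w z)) \<le> cmod (halfplane_to_disk w z)"
    by (rule Schwarz_Lemma(1)[OF hq q0 q1 x])
  then have "1 - (cmod (halfplane_to_disk w z))\<^sup>2 \<le> 1 - (cmod (halfplane_to_disk (F w) (F z)))\<^sup>2"
    using w z by (simp add: q_def halfplane_to_disk_inverse power_mono)
  then have "4 * Im z * Im w / (cmod (z - cnj w))\<^sup>2 \<le> 4 * Im (F z) * Im (F w) / (cmod (F z - cnj (F w)))\<^sup>2"
    using w z F(2) by (simp add: norm_halfplane_to_disk_sq)
  moreover have "(cmod (z - cnj w))\<^sup>2 > 0" "(cmod (F z - cnj (F w)))\<^sup>2 > 0"
    using halfplane_minus_cnj_nonzero w z F(2) by auto
  ultimately have "Im z * Im w * (cmod (F z - cnj (F w)))\<^sup>2 \<le> Im (F z) * Im (F w) * (cmod (z - cnj w))\<^sup>2"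
    by (simp add: field_simps)
  then show ?thesis unfolding norm_diff_cnj_sq by (simp add: algebra_simps)
qed

text \<open>
  The same inequality, as \<open>|z - cnj w|\<^sup>2\<close> and \<open>|z - w|\<^sup>2\<close> differ by \<open>4 Im z Im w\<close>. This form controls
  \<open>F z\<close> when \<open>w\<close> runs to the boundary.
\<close>

lemma Schwarz_Pick_halfplane_cnj:
  assumes F: "F holomorphic_on upper_half_plane" "\<And>z. 0 < Im z \<Longrightarrow> 0 < Im (F z)"
    and z: "0 < Im z" and w: "0 < Im w"
  shows "Im z * Im w * (cmod (F z - cnj (F w)))\<^sup>2 \<le> Im (F z) * Im (F w) * (cmod (z - cnj w))\<^sup>2"
  using Schwarz_Pick_halfplane[OF assms] unfolding norm_diff_cnj_sq by (simp add: algebra_simps)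

text \<open>
  Wolff's lemma: horodisks at the limit of an orbit are mapped into themselves. Schwarz-Pick compares
  \<open>z\<close> with \<open>x\<^sub>n\<close> and \<open>F z\<close> with \<open>x\<^sub>n\<^sub>+\<^sub>1\<close>. Up to factors that tend to 1, the result
  is the claim multiplied by \<open>\<rho> n\<close> on the left and by \<open>\<rho> (n + 1)\<close> on the right, where \<open>\<rho>\<close>
  measures the distance of \<open>x\<^sub>n\<close> from the boundary of the disk model. As \<open>\<rho>\<close> is positive and tends to 0,
  it cannot increase at all late times, so infinitely many \<open>n\<close> can be used in the limit.
\<close>

lemma Wolff_halfplane:
  assumes F: "F holomorphic_on upper_half_plane" "\<And>z. 0 < Im z \<Longrightarrow> 0 < Im (F z)"
    and orbit: "\<And>n. 0 < Im (x n)" "\<And>n. x (Suc n) = F (x n)"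
    and escape: "filterlim x at_infinity sequentially"
    and z: "0 < Im z"
  shows "Im z \<le> Im (F z)"
proof -
  (* Up to the factor 4 this is 1 - |u|^2 for the image u of x n in the disk. *)
  define \<rho> where "\<rho> n = Im (x n) / (cmod (x n + \<i>))\<^sup>2" for n
  have nz: "x n + \<i> \<noteq> 0" for n using orbit(1)[of n] by (auto simp: complex_eq_iff)
  have \<rho>pos: "0 < \<rho> n" for n using orbit(1)[of n] nz[of n] by (simp add: \<rho>_def)
  have xi: "filterlim (\<lambda>n. x n + \<i>) at_infinity sequentially"
    by (rule tendsto_add_filterlim_at_infinity'[OF escape tendsto_const])
  have \<rho>le: "\<rho> n \<le> 1 / cmod (x n + \<i>)" for n
  proof -
    have "Im (x n) \<le> cmod (x n + \<i>)" using abs_Im_le_cmod[of "x n + \<i>"] orbit(1)[of n] by simp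
    then show ?thesis using nz[of n] by (simp add: \<rho>_def field_simps power2_eq_square)
  qed
  have lim0: "(\<lambda>n. 1 / (x n + \<i>)) \<longlonglongrightarrow> 0"
    by (rule tendsto_divide_0[OF tendsto_const xi])
  have \<rho>0: "\<rho> \<longlonglongrightarrow> 0"
    by (rule tendsto_sandwich[OF _ _ tendsto_const])
       (use \<rho>pos \<rho>le tendsto_norm_zero[OF lim0] in \<open>auto simp: norm_divide less_imp_le intro!: eventuallyI\<close>)
  have freq: "\<exists>\<^sub>F n in sequentially. \<rho> (Suc n) \<le> \<rho> n"
  proof (rule ccontr)
    assume "\<not> ?thesis"
    then have "\<forall>\<^sub>F n in sequentially. \<rho> n \<le> \<rho> (Suc n)"
      by (auto simp: not_frequently elim: eventually_mono)
    then obtain N where N: "\<And>n. N \<le> n \<Longrightarrow> \<rho> n \<le> \<rho> (Suc n)"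
      by (auto simp: eventually_sequentially)
    have "\<rho> N \<le> \<rho> n" if "N \<le> n" for n
      using that by (induction rule: dec_induct) (use N order_trans in \<open>blast+\<close>)
    then have "\<rho> N \<le> 0"
      by (intro tendsto_lowerbound[OF \<rho>0]) (auto simp: eventually_sequentially)
    then show False using \<rho>pos[of N] by simp
  qed
  have ratio: "(\<lambda>n. (cmod ((w - cnj (y n)) / (y n + \<i>)))\<^sup>2) \<longlonglongrightarrow> 1"
    if y: "(\<lambda>n. 1 / (y n + \<i>)) \<longlonglongrightarrow> 0" and ny: "\<And>n. y n + \<i> \<noteq> 0" for w and y :: "nat \<Rightarrow> complex"
  proof -
    have "(\<lambda>n. (cnj w + \<i>) * (1 / (y n + \<i>)) - 1) \<longlonglongrightarrow> (cnj w + \<i>) * 0 - 1"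
      by (intro tendsto_intros y)
    then have "(\<lambda>n. (cmod ((cnj w + \<i>) * (1 / (y n + \<i>)) - 1))\<^sup>2) \<longlonglongrightarrow> (cmod ((cnj w + \<i>) * 0 - 1))\<^sup>2"
      by (intro tendsto_power tendsto_norm)
    moreover have "(cnj w + \<i>) * (1 / (y n + \<i>)) - 1 = (cnj w - y n) / (y n + \<i>)" for n
      using ny[of n] by (simp add: field_simps)
    moreover have "cmod ((cnj w - y n) / (y n + \<i>)) = cmod ((w - cnj (y n)) / (y n + \<i>))" for n
      by (metis complex_cnj_cnj complex_cnj_diff complex_mod_cnj norm_divide)
    ultimately show ?thesis by simp
  qed
  define X where "X n = (cmod ((F z - cnj (x (Suc n))) / (x (Suc n) + \<i>)))\<^sup>2" for n
  define Y where "Y n = (cmod ((z - cnj (x n)) / (x n + \<i>)))\<^sup>2" for n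
  have X: "X \<longlonglongrightarrow> 1" unfolding X_def
    by (rule ratio[of "\<lambda>n. x (Suc n)"]) (use nz LIMSEQ_Suc[OF lim0] in auto)
  have Y: "Y \<longlonglongrightarrow> 1" unfolding Y_def by (rule ratio[OF lim0 nz])
  have main: "Im z * X n \<le> Im (F z) * Y n" if "\<rho> (Suc n) \<le> \<rho> n" for n
  proof -
    let ?a = "(cmod (x n + \<i>))\<^sup>2" and ?b = "(cmod (x (Suc n) + \<i>))\<^sup>2"
    have ab: "?a > 0" "?b > 0" using nz by simp_all
    have e1: "X n * ?b = (cmod (F z - cnj (F (x n))))\<^sup>2"
      using nz[of "Suc n"] by (simp add: X_def norm_divide power_divide orbit(2))
    have e2: "Y n * ?a = (cmod (z - cnj (x n)))\<^sup>2"
      using nz[of n] by (simp add: Y_def norm_divide power_divide)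
    have e3: "Im (x n) = \<rho> n * ?a" "Im (F (x n)) = \<rho> (Suc n) * ?b"
      using ab by (simp_all add: \<rho>_def orbit(2))
    have "Im z * (\<rho> n * ?a) * (X n * ?b) \<le> Im (F z) * (\<rho> (Suc n) * ?b) * (Y n * ?a)"
      using Schwarz_Pick_halfplane_cnj[OF F z orbit(1)[of n]] unfolding e1 e2 e3[symmetric] .
    then have "(?a * ?b) * (Im z * \<rho> n * X n) \<le> (?a * ?b) * (Im (F z) * \<rho> (Suc n) * Y n)"
      by (simp add: algebra_simps)
    then have "Im z * \<rho> n * X n \<le> Im (F z) * \<rho> (Suc n) * Y n"
      using ab by (simp add: mult_le_cancel_left)
    also have "\<dots> \<le> Im (F z) * \<rho> n * Y n"
      using that F(2)[OF z] by (intro mult_mono) (auto simp: Y_def less_imp_le[OF \<rho>pos])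
    finally have "\<rho> n * (Im z * X n) \<le> \<rho> n * (Im (F z) * Y n)" by (simp add: algebra_simps)
    then show ?thesis using \<rho>pos[of n] by simp
  qed
  have lim: "(\<lambda>n. Im (F z) * Y n - Im z * X n) \<longlonglongrightarrow> Im (F z) * 1 - Im z * 1"
    by (intro tendsto_intros X Y)
  show ?thesis
  proof (rule ccontr)
    assume "\<not> ?thesis"
    then have "\<forall>\<^sub>F n in sequentially. Im (F z) * Y n - Im z * X n < 0"
      using order_tendstoD(2)[OF lim, of 0] by simp
    with freq have "\<exists>\<^sub>F n in sequentially. \<rho> (Suc n) \<le> \<rho> n \<and> Im (F z) * Y n - Im z * X n < 0"
      by (rule frequently_eventually_frequently)
    then obtain n where "\<rho> (Suc n) \<le> \<rho> n" "Im (F z) * Y n - Im z * X n < 0"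
      by (auto dest!: frequently_ex)
    then show False using main[of n] by simp
  qed
qed

text \<open>
  The hyperbolic distance of consecutive orbit points does not increase, and below a horizontal line
  a bounded hyperbolic step is a bounded Euclidean step.
\<close>

lemma orbit_linear_growth:
  assumes F: "F holomorphic_on upper_half_plane" "\<And>z. 0 < Im z \<Longrightarrow> 0 < Im (F z)"
    and orbit: "\<And>n. 0 < Im (x n)" "\<And>n. x (Suc n) = F (x n)"
    and M: "\<And>n. Im (x n) \<le> M"
  obtains C where "0 < C" "\<And>n. cmod (x n) \<le> C * (1 + real n)"
proof -
  define d where "d n = (cmod (x (Suc n) - x n))\<^sup>2 / (Im (x (Suc n)) * Im (x n))" for n
  have "d (Suc n) \<le> d n" for n
    using Schwarz_Pick_halfplane[OF F orbit(1)[of "Suc n"] orbit(1)[of n]] orbit(1)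
    unfolding orbit(2)[symmetric] by (simp add: d_def field_simps)
  then have d: "d n \<le> d 0" for n
    by (induction n) (use order_trans in blast)+
  define K where "K = sqrt (d 0) * M"
  have M0: "0 \<le> M" using M[of 0] orbit(1)[of 0] by simp
  have d0: "0 \<le> d 0" using orbit(1) by (simp add: d_def less_imp_le)
  have K: "cmod (x (Suc n) - x n) \<le> K" for n
  proof (rule power2_le_imp_le)
    have "(cmod (x (Suc n) - x n))\<^sup>2 = d n * (Im (x (Suc n)) * Im (x n))"
      using orbit(1)[of n] orbit(1)[of "Suc n"] by (simp add: d_def)
    also have "\<dots> \<le> d 0 * (M * M)"
      using d[of n] d0 M M0 orbit(1) by (intro mult_mono) (auto intro: less_imp_le)
    also have "\<dots> = K\<^sup>2" using d0 by (simp add: K_def power2_eq_square)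
    finally show "(cmod (x (Suc n) - x n))\<^sup>2 \<le> K\<^sup>2" .
    show "0 \<le> K" using M0 d0 by (simp add: K_def)
  qed
  have K0: "0 \<le> K" using K[of 0] norm_ge_zero order_trans by blast
  have gr: "cmod (x n) \<le> cmod (x 0) + real n * K" for n
  proof (induction n)
    case (Suc n)
    have "cmod (x (Suc n)) \<le> cmod (x n) + cmod (x (Suc n) - x n)"
      using norm_triangle_ineq[of "x n" "x (Suc n) - x n"] by simp
    with Suc K[of n] show ?case by (simp add: algebra_simps)
  qed simp
  show thesis
  proof (rule that)
    show "0 < cmod (x 0) + K" using orbit(1)[of 0] K0 by (intro add_pos_nonneg) auto
    fix n
    have "0 \<le> real n * cmod (x 0)" by (rule mult_nonneg_nonneg) auto
    moreover have "(cmod (x 0) + K) * (1 + real n) = cmod (x 0) + real n * K + K + real n * cmod (x 0)"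
      by (simp add: algebra_simps)
    ultimately show "cmod (x n) \<le> (cmod (x 0) + K) * (1 + real n)"
      using gr[of n] K0 by linarith
  qed
qed

text \<open>
  Schwarz-Pick for the pair \<open>z\<close>, \<open>x\<^sub>n\<close> bounds \<open>Im (g z) / Im z\<close> from below by a multiple of
  \<open>|g z - cnj w - n|\<^sup>2 / |z - cnj (x\<^sub>n)|\<^sup>2\<close>. Both the numerator and the bound for the denominator
  are of order \<open>n\<^sup>2\<close>, so the estimate survives in the limit. Here \<open>w\<close> plays the part of \<open>g (x\<^sub>0)\<close>.
\<close>

lemma Koenigs_Im_lower_bound:
  assumes g: "g holomorphic_on upper_half_plane" "\<And>z. 0 < Im z \<Longrightarrow> 0 < Im (g z)"
    and x: "\<And>n. g (x n) = w + of_nat n"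
    and m: "0 < m" "\<And>n. m \<le> Im (x n)"
    and C: "0 < C" "\<And>n. cmod (x n) \<le> C * (1 + real n)"
  obtains c where "0 < c" "\<And>z. 0 < Im z \<Longrightarrow> c * Im z \<le> Im (g z)"
proof
  have w: "0 < Im w" using g(2)[of "x 0"] x[of 0] m(1) m(2)[of 0] by simp
  then show "0 < m / (Im w * C\<^sup>2)" using m C by simp
  fix z assume z: "0 < Im z"
  have le: "Im z * m * (cmod (1 - (g z - cnj w) * (1 / of_nat n)))\<^sup>2
       \<le> Im (g z) * Im w * ((cmod z + C) * (1 / real n) + C)\<^sup>2" if n: "0 < n" for n
  proof -
    have pos: "0 < Im (x n)" using m(1) m(2)[of n] by linarith
    have "cmod (z - cnj (x n)) \<le> cmod z + cmod (x n)"
      using norm_triangle_ineq4[of z "cnj (x n)"] by simp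
    also have "\<dots> \<le> cmod z + C * (1 + real n)" using C(2)[of n] by simp
    finally have b: "cmod (z - cnj (x n)) \<le> cmod z + C * (1 + real n)" .
    have "Im z * m * (cmod (g z - cnj (g (x n))))\<^sup>2 \<le> Im z * Im (x n) * (cmod (g z - cnj (g (x n))))\<^sup>2"
      using z m(2)[of n] by (intro mult_right_mono mult_left_mono) auto
    also have "\<dots> \<le> Im (g z) * Im (g (x n)) * (cmod (z - cnj (x n)))\<^sup>2"
      by (rule Schwarz_Pick_halfplane_cnj[OF g z pos])
    also have "\<dots> \<le> Im (g z) * Im (g (x n)) * (cmod z + C * (1 + real n))\<^sup>2"
      using b g(2)[OF z] g(2)[OF pos] by (intro mult_left_mono power_mono) auto
    finally have *: "Im z * m * (cmod (g z - cnj w - of_nat n))\<^sup>2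
        \<le> Im (g z) * Im w * (cmod z + C * (1 + real n))\<^sup>2" by (simp add: x algebra_simps)
    have "1 - (g z - cnj w) * (1 / of_nat n) = - ((g z - cnj w - of_nat n) / of_nat n)"
      using n by (simp add: field_simps)
    then have e1: "(cmod (1 - (g z - cnj w) * (1 / of_nat n)))\<^sup>2 = (cmod (g z - cnj w - of_nat n))\<^sup>2 / (real n)\<^sup>2"
      by (simp add: norm_divide power_divide)
    have "(cmod z + C) * (1 / real n) + C = (cmod z + C * (1 + real n)) / real n"
      using n by (simp add: field_simps)
    then have e2: "((cmod z + C) * (1 / real n) + C)\<^sup>2 = (cmod z + C * (1 + real n))\<^sup>2 / (real n)\<^sup>2"
      by (simp add: power_divide)
    show ?thesis unfolding e1 e2 using * n by (simp add: divide_right_mono)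
  qed
  have "(\<lambda>n. Im z * m * (cmod (1 - (g z - cnj w) * (1 / of_nat n)))\<^sup>2)
       \<longlonglongrightarrow> Im z * m * (cmod (1 - (g z - cnj w) * 0))\<^sup>2"
    by (intro tendsto_intros lim_1_over_n)
  moreover have "(\<lambda>n. Im (g z) * Im w * ((cmod z + C) * (1 / real n) + C)\<^sup>2)
       \<longlonglongrightarrow> Im (g z) * Im w * ((cmod z + C) * 0 + C)\<^sup>2"
    by (intro tendsto_intros lim_1_over_n)
  ultimately have "Im z * m * (cmod (1 - (g z - cnj w) * 0))\<^sup>2 \<le> Im (g z) * Im w * ((cmod z + C) * 0 + C)\<^sup>2"
    by (rule LIMSEQ_le) (use le in \<open>auto intro!: exI[of _ 1]\<close>)
  then show "m / (Im w * C\<^sup>2) * Im z \<le> Im (g z)"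
    using w C by (simp add: field_simps)
qed

text \<open>
  The constant \<open>c\<close> is the infimum of \<open>Im (g z) / Im z\<close>. For small \<open>\<epsilon>\<close> the map \<open>G z = g z - (c - \<epsilon>) z\<close>
  still preserves the half-plane, and some \<open>z0\<close> is lifted only little, \<open>Im (G z0) \<le> 2 \<epsilon> Im z0\<close>.
  Schwarz-Pick based at \<open>z0\<close> carries this smallness along every ray, so \<open>|G (r \<zeta>)| / r\<close> is eventually at
  most of order \<open>\<epsilon>\<close>.
\<close>

lemma Julia_Wolff_Caratheodory_halfplane:
  assumes g: "g holomorphic_on upper_half_plane" "\<And>z. 0 < Im z \<Longrightarrow> 0 < Im (g z)"
    and b: "\<And>z. 0 < Im z \<Longrightarrow> b * Im z \<le> Im (g z)"
  obtains c where "b \<le> c"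
    "\<And>\<zeta>. 0 < Im \<zeta> \<Longrightarrow> ((\<lambda>r. g (of_real r * \<zeta>) / of_real r) \<longlongrightarrow> of_real c * \<zeta>) at_top"
proof
  define Q where "Q = (\<lambda>z. Im (g z) / Im z) ` upper_half_plane"
  define c where "c = Inf Q"
  have ne: "Q \<noteq> {}" unfolding Q_def by (auto intro: exI[of _ "\<i>"])
  have bQ: "b \<le> q" if "q \<in> Q" for q
    using that b by (auto simp: Q_def field_simps)
  show "b \<le> c" unfolding c_def by (rule cInf_greatest[OF ne bQ])
  have c: "c * Im z \<le> Im (g z)" if "0 < Im z" for z
  proof -
    have "c \<le> Im (g z) / Im z" unfolding c_def
      by (rule cInf_lower) (use that bQ in \<open>auto simp: Q_def intro!: bdd_belowI[of _ b]\<close>)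
    then show ?thesis using that by (simp add: field_simps)
  qed
  fix \<zeta> :: complex assume \<zeta>: "0 < Im \<zeta>"
  show "((\<lambda>r. g (of_real r * \<zeta>) / of_real r) \<longlongrightarrow> of_real c * \<zeta>) at_top"
  proof (rule tendstoI)
    fix e :: real assume e: "0 < e"
    (* \<epsilon> A is the limit of the error bound U below. *)
    define A where "A = 2 * (cmod \<zeta>)\<^sup>2 / Im \<zeta> + cmod \<zeta>"
    have "\<zeta> \<noteq> 0" using \<zeta> by auto
    then have A: "0 < A" using \<zeta> by (auto simp: A_def intro!: add_pos_pos divide_pos_pos)
    define \<epsilon> where "\<epsilon> = e / (2 * A)"
    have \<epsilon>: "0 < \<epsilon>" "\<epsilon> * A < e" using e A by (auto simp: \<epsilon>_def)
    have "\<exists>q\<in>Q. q < c + \<epsilon>" unfolding c_def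
      by (rule cInf_lessD[OF ne]) (use \<epsilon> in simp)
    then obtain z0 where z0: "0 < Im z0" "Im (g z0) < (c + \<epsilon>) * Im z0"
      by (auto simp: Q_def field_simps)
    (* Subtracting c - \<epsilon> instead of c keeps the image in the open half-plane even if the infimum is
       attained. *)
    define G where "G z = g z - of_real (c - \<epsilon>) * z" for z
    have ImG: "\<epsilon> * Im z \<le> Im (G z)" if "0 < Im z" for z
      using c[OF that] by (simp add: G_def algebra_simps)
    have Gpos: "0 < Im (G z)" if "0 < Im z" for z
      using ImG[OF that] that \<epsilon>(1) by (meson less_le_trans mult_pos_pos)
    have Ghol: "G holomorphic_on upper_half_plane"
      unfolding G_def by (intro holomorphic_intros g)
    have Gz0: "Im (G z0) \<le> 2 * \<epsilon> * Im z0" using z0 by (simp add: G_def algebra_simps)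
    have bound: "cmod (G z - cnj (G z0)) * Im z \<le> 2 * \<epsilon> * (cmod (z - cnj z0))\<^sup>2" if z: "0 < Im z" for z
    proof -
      let ?N = "cmod (G z - cnj (G z0))"
      have N: "0 < ?N" using halfplane_minus_cnj_nonzero Gpos z z0 by simp
      (* Schwarz-Pick is quadratic in ?N; one factor absorbs Im (G z). *)
      have "Im (G z) \<le> ?N"
        using abs_Im_le_cmod[of "G z - cnj (G z0)"] Gpos[OF z] Gpos[OF z0(1)] by simp
      have "Im z * Im z0 * ?N\<^sup>2 \<le> Im (G z) * Im (G z0) * (cmod (z - cnj z0))\<^sup>2"
        by (rule Schwarz_Pick_halfplane_cnj[OF Ghol Gpos z z0(1)])
      also have "\<dots> \<le> ?N * (2 * \<epsilon> * Im z0) * (cmod (z - cnj z0))\<^sup>2"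
        using \<open>Im (G z) \<le> ?N\<close> Gz0 Gpos[OF z] Gpos[OF z0(1)]
        by (intro mult_right_mono mult_mono) auto
      finally have "(Im z0 * ?N) * (?N * Im z) \<le> (Im z0 * ?N) * (2 * \<epsilon> * (cmod (z - cnj z0))\<^sup>2)"
        by (simp add: power2_eq_square algebra_simps)
      then show ?thesis using N z0(1) by (simp add: mult_le_cancel_left)
    qed
    define U where "U r = 2 * \<epsilon> * (cmod (\<zeta> - cnj z0 * of_real (1 / r)))\<^sup>2 / Im \<zeta>
        + cmod (G z0) * (1 / r) + \<epsilon> * cmod \<zeta>" for r :: real
    have le: "cmod (g (of_real r * \<zeta>) / of_real r - of_real c * \<zeta>) \<le> U r" if r: "0 < r" for r
    proof -
      let ?z = "of_real r * \<zeta>"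
      have z: "0 < Im ?z" using r \<zeta> by simp
      have "?z - cnj z0 = of_real r * (\<zeta> - cnj z0 * of_real (1 / r))"
        using r by (simp add: field_simps)
      then have sq: "(cmod (?z - cnj z0))\<^sup>2 = r\<^sup>2 * (cmod (\<zeta> - cnj z0 * of_real (1 / r)))\<^sup>2"
        by (simp only: norm_mult power_mult_distrib) simp
      have "cmod (G ?z - cnj (G z0)) * (r * Im \<zeta>) \<le> 2 * \<epsilon> * (r\<^sup>2 * (cmod (\<zeta> - cnj z0 * of_real (1 / r)))\<^sup>2)"
        using bound[OF z] unfolding sq by simp
      then have 1: "cmod (G ?z - cnj (G z0)) / r \<le> 2 * \<epsilon> * (cmod (\<zeta> - cnj z0 * of_real (1 / r)))\<^sup>2 / Im \<zeta>"
        using r \<zeta> by (simp add: field_simps power2_eq_square)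
      have "g ?z / of_real r - of_real c * \<zeta> = (G ?z - cnj (G z0)) / of_real r + cnj (G z0) / of_real r - of_real \<epsilon> * \<zeta>"
        using r by (simp add: G_def field_simps)
      then have "cmod (g ?z / of_real r - of_real c * \<zeta>)
          = cmod ((G ?z - cnj (G z0)) / of_real r + cnj (G z0) / of_real r - of_real \<epsilon> * \<zeta>)" by simp
      also have "\<dots> \<le> cmod ((G ?z - cnj (G z0)) / of_real r) + cmod (cnj (G z0) / of_real r) + cmod (of_real \<epsilon> * \<zeta>)"
        by (rule order_trans[OF norm_triangle_ineq4 add_right_mono[OF norm_triangle_ineq]])
      also have "\<dots> \<le> U r" using 1 r \<epsilon>(1) by (simp add: U_def norm_divide norm_mult)
      finally show ?thesis .
    qed
    have inv: "((\<lambda>r::real. 1 / r) \<longlongrightarrow> 0) at_top"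
      using tendsto_inverse_0_at_top[OF filterlim_ident] by (simp add: inverse_eq_divide)
    have "(U \<longlongrightarrow> 2 * \<epsilon> * (cmod (\<zeta> - cnj z0 * of_real 0))\<^sup>2 / Im \<zeta> + cmod (G z0) * 0 + \<epsilon> * cmod \<zeta>) at_top"
      unfolding U_def using \<zeta> by (intro tendsto_intros inv) auto
    then have "(U \<longlongrightarrow> \<epsilon> * A) at_top" by (simp add: A_def algebra_simps)
    then have "\<forall>\<^sub>F r in at_top. U r < e" using \<epsilon>(2) by (rule order_tendstoD)
    then show "\<forall>\<^sub>F r in at_top. dist (g (of_real r * \<zeta>) / of_real r) (of_real c * \<zeta>) < e"
      using eventually_gt_at_top[of 0]
      by eventually_elim (use le in \<open>force simp: dist_norm\<close>)
  qed
qed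

section \<open>The Koenigs function of a semigroup of finite shift\<close>

lemma disk_semigroup_in_disk:
  assumes "disk_semigroup \<phi>" "0 \<le> t" "z \<in> unit_disk"
  shows "\<phi> t z \<in> unit_disk"
  using assms unfolding disk_semigroup_def image_subset_iff by blast

text \<open>
  In the half-plane model with \<open>\<tau>\<close> at infinity, the horodisk of radius \<open>r\<close> at \<open>\<tau>\<close> becomes the half-plane
  \<open>Im > (1 - r) / r\<close>.
\<close>

lemma horodisk_Im_bound:
  assumes \<tau>: "cmod \<tau> = 1" and z: "z \<in> unit_disk" and r: "0 < r"
    and out: "z \<notin> ball (of_real (1 - r) * \<tau>) r"
  shows "Im (disk_to_halfplane \<i> (cnj \<tau> * z)) \<le> (1 - r) / r"
proof -
  define u where "u = cnj \<tau> * z"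
  have u: "cmod u < 1" using z \<tau> by (simp add: u_def norm_mult)
  have "\<tau> * cnj \<tau> = 1" using \<tau> by (metis complex_norm_square of_real_1 power_one)
  then have "z - of_real (1 - r) * \<tau> = \<tau> * (u - of_real (1 - r))"
    by (simp add: u_def algebra_simps)
  then have "cmod (z - of_real (1 - r) * \<tau>) = cmod (u - of_real (1 - r))"
    using \<tau> by (simp add: norm_mult)
  then have "r \<le> cmod (u - of_real (1 - r))"
    using out by (simp add: dist_norm norm_minus_commute)
  then have "r\<^sup>2 \<le> (cmod (u - of_real (1 - r)))\<^sup>2" using r by (intro power_mono) auto
  then have "r * (1 - (cmod u)\<^sup>2) \<le> (1 - r) * (cmod (1 - u))\<^sup>2"
    unfolding cmod_power2 by (simp add: power2_eq_square algebra_simps)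
  moreover have "0 < (cmod (1 - u))\<^sup>2" using u by auto
  ultimately show ?thesis using r u
    by (simp add: Im_disk_to_halfplane flip: u_def) (simp add: field_simps)
qed

text \<open>
  This is where finite shift enters: the orbit outside a horodisk supplies the sequence from
  which the lower bound \<open>Im g \<ge> b Im\<close>, hence \<open>c > 0\<close>, is derived. For a general Koenigs domain in the upper
  half-plane, for instance a quadrant, \<open>c\<close> may vanish.
\<close>

lemma Koenigs_function_asymptotics:
  assumes shift: "finite_shift_semigroup \<phi>" and koenigs: "koenigs_function \<phi> h"
    and im: "h ` unit_disk \<subseteq> upper_half_plane"
  obtains \<tau> c where "cmod \<tau> = 1" "0 < c"
    "\<And>\<zeta>. 0 < Im \<zeta> \<Longrightarrow>
       ((\<lambda>r. h (\<tau> * halfplane_to_disk \<i> (of_real r * \<zeta>)) / of_real r) \<longlongrightarrow> of_real c * \<zeta>) at_top"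
proof -
  have sg: "disk_semigroup \<phi>"
    using shift by (simp add: finite_shift_semigroup_def non_elliptic_semigroup_def)
  obtain \<tau> r z0 where dw: "denjoy_wolff_point \<phi> \<tau>" and r: "0 < r" and z0: "z0 \<in> unit_disk"
    and avoid: "{\<phi> t z0 | t. t \<ge> 0} \<inter> ball (of_real (1 - r) * \<tau>) r = {}"
    using shift unfolding finite_shift_semigroup_def horodisk_def by blast
  have \<tau>: "cmod \<tau> = 1" using dw by (simp add: denjoy_wolff_point_def)
  have \<tau>\<tau>: "\<tau> * cnj \<tau> = 1" using \<tau> by (metis complex_norm_square of_real_1 power_one)
  define H where "H z = disk_to_halfplane \<i> (cnj \<tau> * z)" for z
  define D where "D w = \<tau> * halfplane_to_disk \<i> w" for w
  have H: "0 < Im (H z)" if "z \<in> unit_disk" for z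
    using that \<tau> by (auto simp: H_def norm_mult intro!: Im_disk_to_halfplane_pos)
  have D: "D w \<in> unit_disk" if "0 < Im w" for w
    using that \<tau> norm_halfplane_to_disk_less_1[of \<i> w] by (simp add: D_def norm_mult)
  have DH: "D (H z) = z" if "z \<in> unit_disk" for z
  proof -
    have "cmod (cnj \<tau> * z) < 1" using that \<tau> by (simp add: norm_mult)
    then have "D (H z) = \<tau> * (cnj \<tau> * z)"
      by (simp add: D_def H_def disk_to_halfplane_inverse)
    also have "\<dots> = z" using \<tau>\<tau> by (simp flip: mult.assoc)
    finally show ?thesis .
  qed
  have Hhol: "H holomorphic_on unit_disk"
  proof -
    have "disk_to_halfplane \<i> \<circ> (\<lambda>z. cnj \<tau> * z) holomorphic_on unit_disk"
      by (rule holomorphic_on_compose_gen[OF _ holomorphic_disk_to_halfplane])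
         (use \<tau> in \<open>auto intro!: holomorphic_intros simp: norm_mult\<close>)
    then show ?thesis by (simp add: H_def[abs_def] o_def)
  qed
  have Dhol: "D holomorphic_on upper_half_plane"
    unfolding D_def by (intro holomorphic_intros holomorphic_halfplane_to_disk) simp
  have \<phi>hol: "\<phi> t holomorphic_on unit_disk" and \<phi>: "z \<in> unit_disk \<Longrightarrow> \<phi> t z \<in> unit_disk"
    if "0 \<le> t" for t z using sg that disk_semigroup_in_disk[OF sg] by (simp_all add: disk_semigroup_def)
  have h\<phi>: "h (\<phi> t z) = h z + of_real t" if "0 \<le> t" "z \<in> unit_disk" for t z
    using koenigs that by (simp add: koenigs_function_def)

  define F where "F = H \<circ> (\<phi> 1 \<circ> D)"
  have Fhol: "F holomorphic_on upper_half_plane"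
    unfolding F_def
    by (intro holomorphic_on_compose_gen[OF _ Hhol] holomorphic_on_compose_gen[OF Dhol \<phi>hol])
       (use D \<phi> in auto)
  have F: "0 < Im (F w)" if "0 < Im w" for w
    using H \<phi> D that by (simp add: F_def)
  define x where "x n = H (\<phi> (of_nat n) z0)" for n :: nat
  have xpos: "0 < Im (x n)" for n unfolding x_def by (intro H \<phi> z0) simp
  have xSuc: "x (Suc n) = F (x n)" for n
  proof -
    have "\<phi> (1 + real n) z0 = \<phi> 1 (\<phi> (real n) z0)"
      using sg z0 by (simp add: disk_semigroup_def)
    then show ?thesis using DH \<phi> z0 by (simp add: x_def F_def)
  qed
  have xM: "Im (x n) \<le> (1 - r) / r" for n
    unfolding x_def H_def
  proof (rule horodisk_Im_bound[OF \<tau> \<phi>[OF of_nat_0_le_iff z0] r])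
    have "\<phi> (of_nat n) z0 \<in> {\<phi> t z0 | t. t \<ge> 0}" using of_nat_0_le_iff by blast
    then show "\<phi> (of_nat n) z0 \<notin> ball (of_real (1 - r) * \<tau>) r" using avoid by blast
  qed
  have escape: "filterlim x at_infinity sequentially"
  proof -
    define u where "u n = cnj \<tau> * \<phi> (of_nat n) z0" for n :: nat
    have "((\<lambda>t. \<phi> t z0) \<longlongrightarrow> \<tau>) at_top" using dw z0 by (simp add: denjoy_wolff_point_def)
    then have "(\<lambda>n. \<phi> (of_nat n) z0) \<longlonglongrightarrow> \<tau>"
      using filterlim_real_sequentially by (rule filterlim_compose)
    then have "u \<longlonglongrightarrow> cnj \<tau> * \<tau>" unfolding u_def by (intro tendsto_intros)
    then have u1: "u \<longlonglongrightarrow> 1" using \<tau>\<tau> by (simp add: mult.commute)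
    have "cmod (u n) < 1" for n using \<phi>[OF _ z0, of "real n"] \<tau> by (simp add: u_def norm_mult)
    then have "1 - u n \<noteq> 0" for n by (metis eq_iff_diff_eq_0 less_irrefl norm_one)
    moreover have "(\<lambda>n. 1 - u n) \<longlonglongrightarrow> 0" using tendsto_diff[OF tendsto_const u1, of 1] by simp
    ultimately have den: "filterlim (\<lambda>n. 1 - u n) (at 0) sequentially"
      by (auto simp: filterlim_at)
    have num: "(\<lambda>n. \<i> - cnj \<i> * u n) \<longlonglongrightarrow> \<i> - cnj \<i> * 1" by (intro tendsto_intros u1)
    have "filterlim (\<lambda>n. (\<i> - cnj \<i> * u n) * inverse (1 - u n)) at_infinity sequentially"
      by (rule tendsto_mult_filterlim_at_infinity[OF num _
            filterlim_compose[OF filterlim_inverse_at_infinity den]]) simp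
    then show ?thesis by (simp add: x_def[abs_def] H_def disk_to_halfplane_def u_def divide_inverse)
  qed
  have xm: "Im (x 0) \<le> Im (x n)" for n
  proof (induction n)
    case (Suc n)
    have "Im (x n) \<le> Im (F (x n))"
      by (rule Wolff_halfplane[OF Fhol F xpos xSuc escape xpos])
    with Suc show ?case by (simp add: xSuc)
  qed simp
  obtain C where C: "0 < C" "\<And>n. cmod (x n) \<le> C * (1 + real n)"
    using orbit_linear_growth[of F x "(1 - r) / r", OF Fhol F xpos xSuc xM] by blast

  define g where "g = h \<circ> D"
  have ghol: "g holomorphic_on upper_half_plane"
    unfolding g_def using koenigs D
    by (intro holomorphic_on_compose_gen[OF Dhol, of _ unit_disk]) (auto simp: koenigs_function_def)
  have g: "0 < Im (g w)" if "0 < Im w" for w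
  proof -
    have "h (D w) \<in> upper_half_plane" using im D[OF that] by blast
    then show ?thesis by (simp add: g_def)
  qed
  have gx: "g (x n) = h z0 + of_nat n" for n
    using DH \<phi> z0 h\<phi> by (simp add: g_def x_def)
  obtain b where b: "0 < b" "\<And>z. 0 < Im z \<Longrightarrow> b * Im z \<le> Im (g z)"
    using Koenigs_Im_lower_bound[of g x "h z0" "Im (x 0)" C, OF ghol g gx xpos[of 0] xm C] by blast
  obtain c where "b \<le> c"
    "\<And>\<zeta>. 0 < Im \<zeta> \<Longrightarrow> ((\<lambda>r. g (of_real r * \<zeta>) / of_real r) \<longlongrightarrow> of_real c * \<zeta>) at_top"
    using Julia_Wolff_Caratheodory_halfplane[of g b, OF ghol g b(2)] by blast
  with \<tau> b(1) that[of \<tau> c] show thesis by (simp add: g_def D_def)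
qed

section \<open>Hardy spaces\<close>

lemma continuous_on_circle:
  assumes "f holomorphic_on unit_disk" "0 \<le> r" "r < 1"
  shows "continuous_on A (\<lambda>\<theta>. f (of_real r * cis \<theta>))"
proof -
  have "continuous_on A (\<lambda>\<theta>. of_real r * cis \<theta>)" by (intro continuous_intros)
  moreover have "(\<lambda>\<theta>. of_real r * cis \<theta>) ` A \<subseteq> unit_disk"
    using assms by (auto simp: norm_mult)
  ultimately show ?thesis
    using continuous_on_compose2 holomorphic_on_imp_continuous_on[OF assms(1)] by blast
qed

lemma hardy_integrand_integrable:
  assumes "f holomorphic_on unit_disk" "0 \<le> r" "r < 1" "0 < p"
  shows "(\<lambda>\<theta>. norm (f (of_real r * cis \<theta>)) powr p) integrable_on {0..2 * pi}"
  using assms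
  by (intro integrable_continuous_real continuous_on_powr' continuous_intros continuous_on_circle) auto

lemma hardy_mean_nonneg: "0 \<le> hardy_mean p f r"
  unfolding hardy_mean_def by (cases "(\<lambda>\<theta>. norm (f (of_real r * cis \<theta>)) powr p) integrable_on {0..2 * pi}")
    (auto intro: integral_nonneg simp: not_integrable_integral)

lemma hardy_norm_powr:
  assumes "f \<in> hardy_space p" "1 \<le> p"
  shows "hardy_norm p f powr p = (SUP r\<in>{0..<1}. hardy_mean p f r)"
proof -
  have "0 \<le> hardy_mean p f 0" by (rule hardy_mean_nonneg)
  also have "\<dots> \<le> (SUP r\<in>{0..<1}. hardy_mean p f r)"
    using assms by (intro cSUP_upper) (auto simp: hardy_space_def)
  finally show ?thesis using assms by (simp add: hardy_norm_def powr_powr)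
qed

lemma hardy_mean_le_norm:
  assumes "f \<in> hardy_space p" "1 \<le> p" "0 \<le> r" "r < 1"
  shows "hardy_mean p f r \<le> hardy_norm p f powr p"
  unfolding hardy_norm_powr[OF assms(1,2)]
  using assms by (intro cSUP_upper) (auto simp: hardy_space_def)

lemma hardy_norm_nonneg: "0 \<le> hardy_norm p f"
  by (simp add: hardy_norm_def)

lemma hardy_space_bounded:
  assumes f: "f holomorphic_on unit_disk" and B: "\<And>z. z \<in> unit_disk \<Longrightarrow> cmod (f z) \<le> B"
    and p: "1 \<le> p"
  shows "f \<in> hardy_space p" "hardy_norm p f \<le> (2 * pi) powr (1 / p) * B"
proof -
  have B0: "0 \<le> B" using B[of 0] norm_ge_zero[of "f 0"] by (simp del: norm_ge_zero)
  have mean: "hardy_mean p f r \<le> 2 * pi * B powr p" if "r \<in> {0..<1}" for r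
  proof -
    have "hardy_mean p f r \<le> integral {0..2 * pi} (\<lambda>\<theta>. B powr p)"
      unfolding hardy_mean_def using that p
      by (intro integral_le hardy_integrand_integrable f powr_mono2 B) (auto simp: norm_mult)
    then show ?thesis by simp
  qed
  show mem: "f \<in> hardy_space p"
    using f mean by (auto simp: hardy_space_def intro!: bdd_aboveI[of _ "2 * pi * B powr p"])
  have "hardy_norm p f powr p \<le> 2 * pi * B powr p"
    unfolding hardy_norm_powr[OF mem p] using mean by (intro cSUP_least) auto
  also have "\<dots> = ((2 * pi) powr (1 / p) * B) powr p"
    using p B0 by (simp add: powr_mult powr_powr)
  finally have le: "hardy_norm p f powr p \<le> ((2 * pi) powr (1 / p) * B) powr p" .
  show "hardy_norm p f \<le> (2 * pi) powr (1 / p) * B"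
  proof (rule ccontr)
    assume "\<not> ?thesis"
    then have "((2 * pi) powr (1 / p) * B) powr p < hardy_norm p f powr p"
      using p B0 by (intro powr_less_mono2) auto
    with le show False by simp
  qed
qed

lemma powr_add_le:
  fixes a b p :: real
  assumes "0 \<le> a" "0 \<le> b" "0 \<le> p"
  shows "(a + b) powr p \<le> 2 powr p * (a powr p + b powr p)"
proof -
  have "(a + b) powr p \<le> (2 * max a b) powr p" using assms by (intro powr_mono2) auto
  also have "\<dots> = 2 powr p * (max a b) powr p" using assms by (simp add: powr_mult)
  also have "(max a b) powr p \<le> a powr p + b powr p" by (simp add: max_def)
  finally show ?thesis by simp
qed

lemma hardy_space_diff:
  assumes f: "f \<in> hardy_space p" and g: "g \<in> hardy_space p" and p: "1 \<le> p"
  shows "(\<lambda>z. f z - g z) \<in> hardy_space p"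
proof -
  have hol: "f holomorphic_on unit_disk" "g holomorphic_on unit_disk"
    using f g by (auto simp: hardy_space_def)
  have "hardy_mean p (\<lambda>z. f z - g z) r \<le> 2 powr p * (hardy_norm p f powr p + hardy_norm p g powr p)"
    if r: "r \<in> {0..<1}" for r
  proof -
    let ?z = "\<lambda>\<theta>. of_real r * cis \<theta>"
    have int: "(\<lambda>\<theta>. cmod (f (?z \<theta>)) powr p) integrable_on {0..2*pi}"
      "(\<lambda>\<theta>. cmod (g (?z \<theta>)) powr p) integrable_on {0..2*pi}"
      "(\<lambda>\<theta>. cmod (f (?z \<theta>) - g (?z \<theta>)) powr p) integrable_on {0..2*pi}"
      using r p by (auto intro!: hardy_integrand_integrable[of "\<lambda>z. f z - g z"] hardy_integrand_integrable hol holomorphic_intros)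
    have "hardy_mean p (\<lambda>z. f z - g z) r
        \<le> integral {0..2*pi} (\<lambda>\<theta>. 2 powr p * (cmod (f (?z \<theta>)) powr p + cmod (g (?z \<theta>)) powr p))"
      unfolding hardy_mean_def
    proof (intro integral_le int integrable_on_mult_right integrable_add)
      fix \<theta>
      have "cmod (f (?z \<theta>) - g (?z \<theta>)) powr p \<le> (cmod (f (?z \<theta>)) + cmod (g (?z \<theta>))) powr p"
        using p by (intro powr_mono2 norm_triangle_ineq4) auto
      also have "\<dots> \<le> 2 powr p * (cmod (f (?z \<theta>)) powr p + cmod (g (?z \<theta>)) powr p)"
        using p by (intro powr_add_le) auto
      finally show "cmod (f (?z \<theta>) - g (?z \<theta>)) powr p \<le> 2 powr p * (cmod (f (?z \<theta>)) powr p + cmod (g (?z \<theta>)) powr p)" .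
    qed
    also have "\<dots> = 2 powr p * (hardy_mean p f r + hardy_mean p g r)"
      by (simp add: hardy_mean_def integral_add int)
    also have "\<dots> \<le> 2 powr p * (hardy_norm p f powr p + hardy_norm p g powr p)"
      using r p by (intro mult_left_mono add_mono hardy_mean_le_norm f g) auto
    finally show ?thesis .
  qed
  then show ?thesis using hol
    by (auto simp: hardy_space_def intro!: holomorphic_intros
        bdd_aboveI[of _ "2 powr p * (hardy_norm p f powr p + hardy_norm p g powr p)"])
qed

text \<open>
  Comparison of the first with the \<open>p\<close>-th power, with a free scale \<open>\<epsilon>\<close>. Choosing \<open>\<epsilon>\<close> as the
  Hardy norm makes the resulting bound for point evaluations homogeneous.
\<close>

lemma le_add_powr:
  fixes a \<epsilon> p :: real
  assumes "0 \<le> a" "0 < \<epsilon>" "1 \<le> p"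
  shows "a \<le> \<epsilon> + \<epsilon> powr (1 - p) * a powr p"
proof (cases "a \<le> \<epsilon>")
  case True
  then show ?thesis by (simp add: add_increasing2)
next
  case False
  then have "a = a powr (1 - p) * a powr p" using assms by (simp flip: powr_add)
  also have "\<dots> \<le> \<epsilon> powr (1 - p) * a powr p"
    using False assms by (intro mult_right_mono powr_mono2') auto
  finally show ?thesis using assms by linarith
qed

text \<open>
  Cauchy's integral formula, with the kernel bounded by its largest value on the circle.
\<close>

lemma norm_le_circle_integral:
  assumes f: "f holomorphic_on unit_disk" and r: "0 < r" "r < 1" and z: "cmod z < r"
  shows "2 * pi * cmod (f z) \<le> r / (r - cmod z) * integral {0..2 * pi} (\<lambda>\<theta>. cmod (f (of_real r * cis \<theta>)))"
proof -
  let ?z = "\<lambda>\<theta>. of_real r * cis \<theta>"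
  let ?k = "\<lambda>\<theta>. f (?z \<theta>) / (?z \<theta> - z) * of_real r * \<i> * cis \<theta>"
  have sub: "cball 0 r \<subseteq> unit_disk" "ball 0 r \<subseteq> unit_disk" using r by auto
  have "((\<lambda>u. f u / (u - z)) has_contour_integral (2 * of_real pi * \<i> * f z)) (circlepath 0 r)"
    using z holomorphic_on_imp_continuous_on[OF f] sub
    by (intro Cauchy_integral_circlepath)
       (auto intro: continuous_on_subset holomorphic_on_subset[OF f])
  then have "(?k has_integral (2 * of_real pi * \<i> * f z)) {0..2*pi}"
    by (simp add: circlepath_def has_contour_integral_part_circlepath_iff)
  then have k: "?k integrable_on {0..2*pi}" "integral {0..2*pi} ?k = 2 * of_real pi * \<i> * f z"
    by (auto simp: has_integral_iff)
  have i: "(\<lambda>\<theta>. cmod (f (?z \<theta>))) integrable_on {0..2*pi}"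
    using f r by (intro integrable_continuous_real continuous_intros continuous_on_circle) auto
  have "2 * pi * cmod (f z) = cmod (integral {0..2*pi} ?k)" unfolding k(2) by (simp add: norm_mult)
  also have "\<dots> \<le> integral {0..2*pi} (\<lambda>\<theta>. r / (r - cmod z) * cmod (f (?z \<theta>)))"
  proof (intro integral_norm_bound_integral k(1) integrable_on_mult_right i)
    fix \<theta>
    have "r - cmod z \<le> cmod (?z \<theta> - z)"
      using norm_triangle_ineq2[of "?z \<theta>" z] r by (simp add: norm_mult)
    then have "cmod (f (?z \<theta>)) * r / cmod (?z \<theta> - z) \<le> cmod (f (?z \<theta>)) * r / (r - cmod z)"
      using z r by (intro divide_left_mono) (auto intro!: mult_pos_pos)
    then show "cmod (?k \<theta>) \<le> r / (r - cmod z) * cmod (f (?z \<theta>))"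
      using r by (simp add: norm_mult norm_divide mult.commute)
  qed
  finally show ?thesis by simp
qed

text \<open>
  Cauchy's formula on the circle halfway between \<open>z\<close> and the unit circle. The sharp exponent of
  \<open>1 - |z|\<close> would be \<open>-1 / p\<close>; any polynomial bound suffices against exponential growth.
\<close>

lemma hardy_point_evaluation:
  assumes f: "f \<in> hardy_space p" and p: "1 \<le> p" and z: "z \<in> unit_disk"
  shows "cmod (f z) \<le> 3 * hardy_norm p f / (1 - cmod z)"
proof -
  have hol: "f holomorphic_on unit_disk" using f by (simp add: hardy_space_def)
  define r where "r = (1 + cmod z) / 2"
  have r: "0 < r" "r < 1" "cmod z < r" using z by (auto simp: r_def add_pos_nonneg)
  let ?N = "hardy_norm p f"
  have le: "cmod (f z) \<le> (2 * pi * \<epsilon> + \<epsilon> powr (1 - p) * ?N powr p) / (pi * (1 - cmod z))"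
    if \<epsilon>: "0 < \<epsilon>" for \<epsilon>
  proof -
    let ?z = "\<lambda>\<theta>. of_real r * cis \<theta>"
    have int: "(\<lambda>\<theta>. cmod (f (?z \<theta>)) powr p) integrable_on {0..2*pi}"
      using hol r p by (intro hardy_integrand_integrable) auto
    have i: "(\<lambda>\<theta>. cmod (f (?z \<theta>))) integrable_on {0..2*pi}"
      using hol r by (intro integrable_continuous_real continuous_intros continuous_on_circle) auto
    have "integral {0..2*pi} (\<lambda>\<theta>. cmod (f (?z \<theta>)))
       \<le> integral {0..2*pi} (\<lambda>\<theta>. \<epsilon> + \<epsilon> powr (1 - p) * cmod (f (?z \<theta>)) powr p)"
      using \<epsilon> p by (intro integral_le i integrable_add integrable_on_mult_right int le_add_powr) auto
    also have "\<dots> = 2 * pi * \<epsilon> + \<epsilon> powr (1 - p) * hardy_mean p f r"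
      by (subst integral_add) (auto simp: hardy_mean_def intro!: integrable_on_mult_right int)
    also have "\<dots> \<le> 2 * pi * \<epsilon> + \<epsilon> powr (1 - p) * ?N powr p"
      using r by (intro add_left_mono mult_left_mono hardy_mean_le_norm f p) auto
    finally have I: "integral {0..2*pi} (\<lambda>\<theta>. cmod (f (?z \<theta>))) \<le> 2 * pi * \<epsilon> + \<epsilon> powr (1 - p) * ?N powr p" .
    have "2 * pi * cmod (f z) \<le> r / (r - cmod z) * integral {0..2*pi} (\<lambda>\<theta>. cmod (f (?z \<theta>)))"
      by (rule norm_le_circle_integral[OF hol r])
    also have "\<dots> \<le> 1 / (r - cmod z) * (2 * pi * \<epsilon> + \<epsilon> powr (1 - p) * ?N powr p)"
      using r I by (intro mult_mono divide_right_mono) (auto intro!: integral_nonneg i)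
    also have "1 / (r - cmod z) = 2 / (1 - cmod z)" by (simp add: r_def field_simps)
    finally show ?thesis using z by (simp add: field_simps)
  qed
  show ?thesis
  proof (cases "?N = 0")
    (* The scale \<epsilon> must be positive, so here it is taken proportional to a supposed value |f z| > 0. *)
    case True
    have "cmod (f z) \<le> 0"
    proof (rule ccontr)
      assume n: "\<not> ?thesis"
      define \<epsilon> where "\<epsilon> = cmod (f z) * (1 - cmod z) / 4"
      have "0 < \<epsilon>" using n z by (auto simp: \<epsilon>_def)
      from le[OF this] have "cmod (f z) \<le> 2 * \<epsilon> / (1 - cmod z)" using True p by simp
      also have "\<dots> = cmod (f z) / 2" using z by (simp add: \<epsilon>_def divide_simps)
      finally show False using n by simp
    qed
    then show ?thesis using True by simp
  next
    case False
    then have N: "0 < ?N" using hardy_norm_nonneg[of p f] by simp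
    have e: "?N powr (1 - p) * ?N powr p = ?N" using N by (simp flip: powr_add)
    have "cmod (f z) \<le> (2 * pi * ?N + ?N) / (pi * (1 - cmod z))"
      using le[OF N] unfolding e .
    also have "\<dots> \<le> (3 * pi * ?N) / (pi * (1 - cmod z))"
    proof (rule divide_right_mono)
      have "?N \<le> pi * ?N" using N pi_ge_two by simp
      then show "2 * pi * ?N + ?N \<le> 3 * pi * ?N" by linarith
    qed (use z in auto)
    also have "\<dots> = 3 * ?N / (1 - cmod z)" by simp
    finally show ?thesis .
  qed
qed

lemma hardy_tendsto_imp_tendsto:
  assumes lim: "hardy_tendsto p F g A" and p: "1 \<le> p" and z: "z \<in> unit_disk"
  shows "((\<lambda>t. F t z) \<longlongrightarrow> g z) A"
proof -
  have "((\<lambda>t. 3 * hardy_norm p (\<lambda>z. F t z - g z) / (1 - cmod z)) \<longlongrightarrow> 3 * 0 / (1 - cmod z)) A"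
    using lim z by (intro tendsto_intros) (auto simp: hardy_tendsto_def)
  moreover have "\<forall>\<^sub>F t in A. cmod (F t z - g z) \<le> 3 * hardy_norm p (\<lambda>z. F t z - g z) / (1 - cmod z)"
    using lim unfolding hardy_tendsto_def
    by (auto elim!: eventually_mono intro!: hardy_point_evaluation[OF hardy_space_diff] p z)
  ultimately have "((\<lambda>t. F t z - g z) \<longlongrightarrow> 0) A"
    using Lim_null_comparison[of "\<lambda>t. F t z - g z" "\<lambda>t. 3 * hardy_norm p (\<lambda>z. F t z - g z) / (1 - cmod z)" A]
    by simp
  then show ?thesis by (rule LIM_zero_cancel)
qed

section \<open>Eigenfunctions of the generator\<close>

text \<open>
  In the coordinate \<open>w = h z\<close> the semigroup is translation by \<open>t\<close>, so the eigenvalue equation says that the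
  one-sided real derivative of the holomorphic \<open>F = f \<circ> h\<^sup>-\<^sup>1\<close> is \<open>\<mu> F\<close>. That is already its complex
  derivative, and \<open>F w * exp (- \<mu> w)\<close> is constant on the connected domain.
\<close>

lemma Koenigs_eigenfunction:
  assumes sg: "disk_semigroup \<phi>" and koenigs: "koenigs_function \<phi> h" and p: "1 \<le> p"
    and eig: "(f, \<lambda>z. \<mu> * f z) \<in> hardy_generator p \<phi>"
  obtains k where "\<And>z. z \<in> unit_disk \<Longrightarrow> f z = k * exp (\<mu> * h z)"
proof -
  have h: "h holomorphic_on unit_disk" "inj_on h unit_disk"
    using koenigs by (auto simp: koenigs_function_def)
  have fhol: "f holomorphic_on unit_disk"
    using eig by (auto simp: hardy_generator_def hardy_space_def)
  obtain q where qhol: "q holomorphic_on h ` unit_disk" and q: "\<And>z. z \<in> unit_disk \<Longrightarrow> q (h z) = z"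
    using holomorphic_has_inverse[OF h(1) open_ball h(2)] by metis
  define \<Omega> where "\<Omega> = h ` unit_disk"
  have op: "open \<Omega>" unfolding \<Omega>_def by (rule open_mapping_thm3[OF h(1) open_ball h(2)])
  have con: "connected \<Omega>" unfolding \<Omega>_def
    by (intro connected_continuous_image holomorphic_on_imp_continuous_on h connected_ball)
  define F where "F = f \<circ> q"
  have Fhol: "F holomorphic_on \<Omega>"
    unfolding F_def \<Omega>_def by (rule holomorphic_on_compose_gen[OF qhol fhol]) (use q in auto)
  have F': "(F has_field_derivative \<mu> * F w) (at w)" if "w \<in> \<Omega>" for w
  proof -
    from that obtain z where z: "z \<in> unit_disk" "w = h z" unfolding \<Omega>_def by blast
    define d where "d = deriv F w"
    have d: "(F has_field_derivative d) (at w)"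
      unfolding d_def by (rule holomorphic_derivI[OF Fhol op that])
    have "((\<lambda>y. (F y - F w) / (y - w)) \<longlongrightarrow> d) (at w)"
      using d by (simp add: has_field_derivative_iff)
    moreover have "filterlim (\<lambda>t. w + of_real t) (at w) (at_right 0)"
    proof -
      have "((\<lambda>t::real. w + of_real t) \<longlongrightarrow> w + of_real 0) (at_right 0)" by (intro tendsto_intros)
      then show ?thesis by (auto simp: filterlim_at eventually_at_filter)
    qed
    ultimately have 1: "((\<lambda>t. (F (w + of_real t) - F w) / (w + of_real t - w)) \<longlongrightarrow> d) (at_right 0)"
      by (rule filterlim_compose)
    have "((\<lambda>t. (composition_semigroup \<phi> t f z - f z) / of_real t) \<longlongrightarrow> \<mu> * f z) (at_right 0)"
      using eig z(1) by (intro hardy_tendsto_imp_tendsto[OF _ p]) (auto simp: hardy_generator_def)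
    moreover have "\<forall>\<^sub>F t in at_right 0. (composition_semigroup \<phi> t f z - f z) / of_real t
        = (F (w + of_real t) - F w) / (w + of_real t - w)"
      using eventually_at_right_less[of "0::real"]
    proof eventually_elim
      case (elim t)
      have "\<phi> t z \<in> unit_disk" using disk_semigroup_in_disk[OF sg _ z(1)] elim by simp
      moreover have "h (\<phi> t z) = w + of_real t"
        using koenigs z elim by (simp add: koenigs_function_def)
      ultimately have "q (w + of_real t) = \<phi> t z" using q by metis
      then show ?case using z q by (simp add: F_def composition_semigroup_def)
    qed
    ultimately have 2: "((\<lambda>t. (F (w + of_real t) - F w) / (w + of_real t - w)) \<longlongrightarrow> \<mu> * f z) (at_right 0)"
      by (rule Lim_transform_eventually)
    have "d = \<mu> * f z" using tendsto_unique[OF _ 1 2] by simp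
    then show ?thesis using d z q by (simp add: F_def)
  qed
  define E where "E w = F w * exp (- (\<mu> * w))" for w
  have E': "(E has_field_derivative 0) (at w)" if "w \<in> \<Omega>" for w
    unfolding E_def by (rule derivative_eq_intros F'[OF that] refl)+ (simp add: algebra_simps)
  obtain k where k: "\<And>w. w \<in> \<Omega> \<Longrightarrow> E w = k"
  proof (rule DERIV_zero_connected_constant[of \<Omega> "{}" E])
    show "continuous_on \<Omega> E"
      unfolding E_def by (intro continuous_intros holomorphic_on_imp_continuous_on Fhol)
  qed (use op con E' in auto)
  show thesis
  proof (rule that)
    fix z assume z: "z \<in> unit_disk"
    have "f z * exp (- (\<mu> * h z)) = k"
      using k[of "h z"] z q by (simp add: E_def F_def \<Omega>_def)
    then show "f z = k * exp (\<mu> * h z)" by (simp add: exp_minus field_simps)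
  qed
qed

text \<open>
  If \<open>Re (\<mu> \<zeta>) > 0\<close>, then \<open>exp (Re (\<mu> g))\<close> grows exponentially in \<open>r\<close> along the ray \<open>r \<zeta>\<close>, but the assumed bound
  is \<open>O(r)\<close> there.
\<close>

lemma Re_direction_nonpos:
  assumes lim: "((\<lambda>r. g (of_real r * \<zeta>) / of_real r) \<longlongrightarrow> of_real c * \<zeta>) at_top"
    and c: "0 < c" and \<zeta>: "0 < Im \<zeta>"
    and growth: "\<And>w. 0 < Im w \<Longrightarrow> exp (Re (\<mu> * g w)) \<le> B * (cmod (w + \<i>))\<^sup>2 / Im w"
  shows "Re (\<mu> * \<zeta>) \<le> 0"
proof (rule ccontr)
  assume neg: "\<not> ?thesis"
  define \<delta> where "\<delta> = c * Re (\<mu> * \<zeta>) / 2"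
  have \<delta>: "0 < \<delta>" using neg c by (simp add: \<delta>_def)
  define B' where "B' = \<bar>B\<bar> * (cmod \<zeta> + 1)\<^sup>2 / Im \<zeta>"
  have "((\<lambda>r. Re (\<mu> * (g (of_real r * \<zeta>) / of_real r))) \<longlongrightarrow> Re (\<mu> * (of_real c * \<zeta>))) at_top"
    by (intro tendsto_intros lim)
  moreover have "Re (\<mu> * (of_real c * \<zeta>)) = 2 * \<delta>" by (simp add: \<delta>_def algebra_simps)
  ultimately have "\<forall>\<^sub>F r in at_top. \<delta> < Re (\<mu> * (g (of_real r * \<zeta>) / of_real r))"
    using \<delta> by (auto dest: order_tendstoD(1)[where a = \<delta>])
  moreover have "\<forall>\<^sub>F r::real in at_top. 1 \<le> r" "\<forall>\<^sub>F r in at_top. 2 * B' / \<delta>\<^sup>2 \<le> r"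
    by (simp_all add: eventually_ge_at_top)
  ultimately have "\<forall>\<^sub>F r in at_top. \<delta> < Re (\<mu> * (g (of_real r * \<zeta>) / of_real r)) \<and> 1 \<le> r \<and> 2 * B' / \<delta>\<^sup>2 \<le> r"
    by eventually_elim auto
  then obtain r where r: "\<delta> < Re (\<mu> * (g (of_real r * \<zeta>) / of_real r))" "1 \<le> r" "2 * B' / \<delta>\<^sup>2 \<le> r"
    by (auto dest: eventually_happens)
  let ?w = "of_real r * \<zeta>"
  have "\<mu> * (g ?w / of_real r) = (\<mu> * g ?w) / of_real r" by simp
  then have "\<delta> * r \<le> Re (\<mu> * g ?w)" using r by (simp add: field_simps)
  then have "exp (\<delta> * r) \<le> exp (Re (\<mu> * g ?w))" by simp
  also have "\<dots> \<le> B * (cmod (?w + \<i>))\<^sup>2 / Im ?w" using r \<zeta> by (intro growth) simp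
  also have "\<dots> \<le> \<bar>B\<bar> * (r * (cmod \<zeta> + 1))\<^sup>2 / Im ?w"
  proof -
    have "cmod (?w + \<i>) \<le> r * (cmod \<zeta> + 1)"
      using norm_triangle_ineq[of ?w \<i>] r by (simp add: norm_mult algebra_simps)
    then show ?thesis using r \<zeta> by (intro divide_right_mono mult_mono power_mono) auto
  qed
  also have "\<dots> = B' * r" using r \<zeta> by (simp add: B'_def field_simps power2_eq_square)
  finally have "exp (\<delta> * r) \<le> B' * r" .
  moreover have "1 + \<delta> * r + (\<delta> * r)\<^sup>2 / 2 \<le> exp (\<delta> * r)"
    using \<delta> r by (intro exp_lower_Taylor_quadratic) auto
  moreover have "B' * r \<le> (\<delta> * r)\<^sup>2 / 2"
  proof -
    have "2 * B' \<le> r * \<delta>\<^sup>2" using r \<delta> by (simp add: field_simps)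
    then have "2 * B' * r \<le> r * \<delta>\<^sup>2 * r" using r by (intro mult_right_mono) auto
    then show ?thesis by (simp add: power2_eq_square algebra_simps)
  qed
  moreover have "0 < \<delta> * r" using \<delta> r by simp
  ultimately show False by linarith
qed

text \<open>
  On the disk the difference quotients are the scalar multiples \<open>d t * f\<close>
  of \<open>f = exp (\<mu> h)\<close> with \<open>d t = (exp (\<mu> t) - 1) / t\<close>, so convergence in norm reduces to convergence of \<open>d t\<close> to \<open>\<mu>\<close>.
\<close>

lemma hardy_generator_exp_Koenigs:
  assumes sg: "disk_semigroup \<phi>" and koenigs: "koenigs_function \<phi> h" and p: "1 \<le> p"
    and bd: "\<And>z. z \<in> unit_disk \<Longrightarrow> cmod (exp (\<mu> * h z)) \<le> B"
  shows "(\<lambda>z. exp (\<mu> * h z), \<lambda>z. \<mu> * exp (\<mu> * h z)) \<in> hardy_generator p \<phi>"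
proof -
  define f where "f z = exp (\<mu> * h z)" for z
  have fhol: "f holomorphic_on unit_disk"
    unfolding f_def using koenigs by (auto simp: koenigs_function_def intro!: holomorphic_intros)
  have fB: "cmod (f z) \<le> B" if "z \<in> unit_disk" for z using bd that by (simp add: f_def)
  define d where "d t = (exp (\<mu> * of_real t) - 1) / of_real t" for t :: real
  define Q where "Q t z = (composition_semigroup \<phi> t f z - f z) / of_real t" for t z
  have Qhol: "Q t holomorphic_on unit_disk" and Q: "z \<in> unit_disk \<Longrightarrow> Q t z = d t * f z"
    if t: "0 < t" for t z
  proof -
    have \<phi>: "\<phi> t holomorphic_on unit_disk" "\<phi> t ` unit_disk \<subseteq> unit_disk"
      using sg t by (auto simp: disk_semigroup_def)
    show "Q t holomorphic_on unit_disk"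
      unfolding Q_def composition_semigroup_def
      using t by (intro holomorphic_intros holomorphic_on_compose_gen[OF \<phi>(1) fhol] fhol) (use \<phi> in auto)
    assume "z \<in> unit_disk"
    then have "h (\<phi> t z) = h z + of_real t" using koenigs t by (simp add: koenigs_function_def)
    then show "Q t z = d t * f z"
      by (simp add: Q_def composition_semigroup_def f_def d_def exp_add ring_distribs diff_divide_distrib)
  qed
  have mem: "Q t \<in> hardy_space p" if "0 < t" for t
    by (rule hardy_space_bounded(1)[OF Qhol[OF that] _ p, of "cmod (d t) * B"])
       (auto simp: Q[OF that] norm_mult fB intro!: mult_left_mono)
  have norm: "hardy_norm p (\<lambda>z. Q t z - \<mu> * f z) \<le> (2 * pi) powr (1 / p) * (cmod (d t - \<mu>) * B)"
    if "0 < t" for t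
  proof (rule hardy_space_bounded(2)[OF _ _ p])
    show "(\<lambda>z. Q t z - \<mu> * f z) holomorphic_on unit_disk"
      by (intro holomorphic_intros Qhol that fhol)
    fix z :: complex assume z: "z \<in> unit_disk"
    have "Q t z - \<mu> * f z = (d t - \<mu>) * f z" by (simp add: Q[OF that z] algebra_simps)
    then show "cmod (Q t z - \<mu> * f z) \<le> cmod (d t - \<mu>) * B"
      using fB[OF z] by (simp add: norm_mult mult_left_mono)
  qed
  have "((\<lambda>w. exp (\<mu> * w)) has_field_derivative \<mu>) (at 0)"
    by (auto intro!: derivative_eq_intros)
  then have "((\<lambda>w. (exp (\<mu> * w) - 1) / w) \<longlongrightarrow> \<mu>) (at 0)"
    by (simp add: has_field_derivative_iff)
  moreover have "filterlim complex_of_real (at 0) (at_right 0)"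
    using tendsto_of_real[OF tendsto_ident_at, of "0::real" "{0<..}"]
    by (auto simp: filterlim_at eventually_at_filter)
  ultimately have d: "(d \<longlongrightarrow> \<mu>) (at_right 0)"
    unfolding d_def by (rule filterlim_compose)
  have "((\<lambda>t. (2 * pi) powr (1 / p) * (cmod (d t - \<mu>) * B)) \<longlongrightarrow> (2 * pi) powr (1 / p) * (cmod (\<mu> - \<mu>) * B)) (at_right 0)"
    by (intro tendsto_intros d)
  then have "((\<lambda>t. (2 * pi) powr (1 / p) * (cmod (d t - \<mu>) * B)) \<longlongrightarrow> 0) (at_right 0)" by simp
  moreover have "\<forall>\<^sub>F t in at_right 0. norm (hardy_norm p (\<lambda>z. Q t z - \<mu> * f z))
      \<le> (2 * pi) powr (1 / p) * (cmod (d t - \<mu>) * B)"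
    using eventually_at_right_less[of "0::real"]
    by eventually_elim (simp add: hardy_norm_nonneg norm)
  ultimately have "((\<lambda>t. hardy_norm p (\<lambda>z. Q t z - \<mu> * f z)) \<longlongrightarrow> 0) (at_right 0)"
    by (rule Lim_null_comparison[rotated])
  moreover have "f \<in> hardy_space p" by (rule hardy_space_bounded(1)[OF fhol fB p])
  moreover have "(\<lambda>z. \<mu> * f z) \<in> hardy_space p"
    by (rule hardy_space_bounded(1)[OF _ _ p, of _ "cmod \<mu> * B"])
       (auto intro!: holomorphic_intros fhol mult_left_mono fB simp: norm_mult)
  moreover have "\<forall>\<^sub>F t in at_right 0. Q t \<in> hardy_space p"
    using eventually_at_right_less[of "0::real"] by eventually_elim (rule mem)
  ultimately have "hardy_tendsto p Q (\<lambda>z. \<mu> * f z) (at_right 0)"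
    by (simp add: hardy_tendsto_def)
  with \<open>f \<in> hardy_space p\<close> have "(f, \<lambda>z. \<mu> * f z) \<in> hardy_generator p \<phi>"
    by (simp add: hardy_generator_def Q_def[abs_def])
  then show ?thesis by (simp add: f_def[abs_def])
qed

theorem corollary5p16:
  fixes \<phi> :: "real \<Rightarrow> complex \<Rightarrow> complex" and h :: "complex \<Rightarrow> complex" and p :: real
  assumes "finite_shift_semigroup \<phi>"
    and "koenigs_function \<phi> h"
    and "h ` unit_disk \<subseteq> {w. Im w > 0}"
    and "p \<ge> 1"
  shows "hardy_point_spectrum p \<phi> = {\<i> * of_real t | t. t \<ge> 0}"
proof
  have sg: "disk_semigroup \<phi>"
    using assms(1) by (simp add: finite_shift_semigroup_def non_elliptic_semigroup_def)
  show "{\<i> * of_real t | t. t \<ge> 0} \<subseteq> hardy_point_spectrum p \<phi>"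
  proof clarify
    fix t :: real assume t: "0 \<le> t"
    have "cmod (exp (\<i> * of_real t * h z)) \<le> 1" if "z \<in> unit_disk" for z
    proof -
      have "0 < Im (h z)" using assms(3) that by blast
      then have "0 \<le> t * Im (h z)" using t by simp
      then show ?thesis by simp
    qed
    then have "(\<lambda>z. exp (\<i> * of_real t * h z), \<lambda>z. \<i> * of_real t * exp (\<i> * of_real t * h z))
        \<in> hardy_generator p \<phi>"
      by (rule hardy_generator_exp_Koenigs[OF sg assms(2,4)])
    then show "\<i> * of_real t \<in> hardy_point_spectrum p \<phi>"
      unfolding hardy_point_spectrum_def by (auto intro!: bexI[of _ 0])
  qed
  show "hardy_point_spectrum p \<phi> \<subseteq> {\<i> * of_real t | t. t \<ge> 0}"
  proof
    fix \<mu> assume "\<mu> \<in> hardy_point_spectrum p \<phi>"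
    then obtain f z1 where eig: "(f, \<lambda>z. \<mu> * f z) \<in> hardy_generator p \<phi>"
      and z1: "z1 \<in> unit_disk" "f z1 \<noteq> 0"
      by (auto simp: hardy_point_spectrum_def)
    obtain k where k: "\<And>z. z \<in> unit_disk \<Longrightarrow> f z = k * exp (\<mu> * h z)"
      using Koenigs_eigenfunction[OF sg assms(2,4) eig] by blast
    have k0: "k \<noteq> 0" using k[OF z1(1)] z1(2) by auto
    have fH: "f \<in> hardy_space p" using eig by (simp add: hardy_generator_def)
    obtain \<tau> c where \<tau>: "cmod \<tau> = 1" and c: "0 < c"
      and lim: "\<And>\<zeta>. 0 < Im \<zeta> \<Longrightarrow>
       ((\<lambda>r. h (\<tau> * halfplane_to_disk \<i> (of_real r * \<zeta>)) / of_real r) \<longlongrightarrow> of_real c * \<zeta>) at_top"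
      using Koenigs_function_asymptotics[OF assms(1-3)] by blast
    define N where "N = hardy_norm p f"
    (* In the half-plane coordinate, 1 - |z|^2 is 4 Im w / |w + \<i>|^2. *)
    have growth: "exp (Re (\<mu> * h (\<tau> * halfplane_to_disk \<i> w))) \<le> (3 * N / (2 * cmod k)) * (cmod (w + \<i>))\<^sup>2 / Im w"
      if w: "0 < Im w" for w
    proof -
      let ?z = "\<tau> * halfplane_to_disk \<i> w"
      have n: "cmod ?z < 1" using norm_halfplane_to_disk_less_1[of \<i> w] w \<tau> by (simp add: norm_mult)
      have "2 * (2 * Im w / (cmod (w + \<i>))\<^sup>2) = 1 - (cmod ?z)\<^sup>2"
        using norm_halfplane_to_disk_sq[of \<i> w] w \<tau> by (simp add: norm_mult)
      also have "\<dots> = (1 + cmod ?z) * (1 - cmod ?z)" by (simp add: power2_eq_square algebra_simps)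
      also have "\<dots> \<le> 2 * (1 - cmod ?z)" using n by (intro mult_right_mono) auto
      finally have low: "2 * Im w / (cmod (w + \<i>))\<^sup>2 \<le> 1 - cmod ?z" by simp
      have wi: "w + \<i> \<noteq> 0" using w by (auto simp: complex_eq_iff)
      have "cmod k * exp (Re (\<mu> * h ?z)) = cmod (f ?z)" using k[of ?z] n by (simp add: norm_mult norm_exp)
      also have "\<dots> \<le> 3 * N / (1 - cmod ?z)"
        unfolding N_def using n by (intro hardy_point_evaluation fH assms) simp
      also have "\<dots> \<le> 3 * N / (2 * Im w / (cmod (w + \<i>))\<^sup>2)"
        using low w wi n hardy_norm_nonneg[of p f]
        by (intro divide_left_mono) (auto simp: N_def intro!: mult_pos_pos divide_pos_pos)
      finally show ?thesis using k0 w wi by (simp add: field_simps)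
    qed
    have dir: "Re (\<mu> * \<zeta>) \<le> 0" if "0 < Im \<zeta>" for \<zeta>
      by (rule Re_direction_nonpos[OF lim[OF that] c that growth])
    have "Re \<mu> = 0"
    proof (rule ccontr)
      assume a: "Re \<mu> \<noteq> 0"
      (* A direction close enough to the real axis, on the side where Re \<mu> dominates. *)
      have "Re (\<mu> * Complex ((\<bar>Im \<mu>\<bar> + 1) / Re \<mu>) 1) = \<bar>Im \<mu>\<bar> + 1 - Im \<mu>" using a by simp
      with dir[of "Complex ((\<bar>Im \<mu>\<bar> + 1) / Re \<mu>) 1"] show False by simp
    qed
    moreover have "0 \<le> Im \<mu>" using dir[of \<i>] by simp
    ultimately have "\<mu> = \<i> * of_real (Im \<mu>)" "0 \<le> Im \<mu>" by (auto simp: complex_eq_iff)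
    then show "\<mu> \<in> {\<i> * of_real t | t. t \<ge> 0}" by blast
  qed
qed

end
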